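(* Every Hilbert geometry $(X,d)$ is uniformly contractible.
   Context: Hilbert geometry: for a non-empty bounded convex domain (open set) $X\subset\mathbb{R}^n$, $n\ge 2$, and distinct $x,y\in X$, the line through $x$ and $y$ meets $\partial X=\overline X\setminus X$ in exactly two points $x',y'$, labelled so that $x',x,y,y'$ are in this order; set $d(x,y)=\log\frac{|xy'||yx'|}{|xx'||yy'|}$ ($|\cdot\,\cdot|$ is Euclidean distance) and $d(x,x)=0$. This is the Hilbert metric and $(X,d)$ is the Hilbert geometry. Uniformly contractible: a metric space $(Y,d_Y)$ is uniformly contractible if for any $R>0$ there exists $S\ge R$ such that, for every $y\in Y$, the closed ball $B_Y(y,R)$ is contractible to a point in the closed ball $B_Y(y,S)$ (i.e. the inclusion $B_Y(y,R)\hookrightarrow B_Y(y,S)$ is homotopic to a constant map). *)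

theory Defs
  imports "HOL-Analysis.Analysis"
begin

section \<open>The Hilbert metric\<close>

text \<open>
  For distinct \<open>x\<close>, \<open>y\<close> in \<open>X\<close>, \<open>ray_exit X x y\<close> is the boundary point \<open>y'\<close> such that \<open>x\<close>, \<open>y\<close>, \<open>y'\<close> lie
  on a line in this order; the other boundary point \<open>x'\<close> on that line is \<open>ray_exit X y x\<close>
  (see \<open>line_Int_frontier\<close> below). For open \<open>X\<close>, \<open>frontier X\<close> is \<open>closure X - X\<close>.
\<close>

definition ray_exit :: "'a::euclidean_space set \<Rightarrow> 'a \<Rightarrow> 'a \<Rightarrow> 'a" where
  "ray_exit X x y = (THE z. z \<in> frontier X \<and> y \<in> open_segment x z)"

text \<open>The value \<open>0\<close> outside \<open>X\<close> is needed because the locale \<open>Metric_space\<close> requires a distance to be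
  nonnegative and symmetric on the whole type.\<close>

definition hilbert_dist :: "'a::euclidean_space set \<Rightarrow> 'a \<Rightarrow> 'a \<Rightarrow> real" where
  "hilbert_dist X x y =
    (if x \<in> X \<and> y \<in> X \<and> x \<noteq> y then
       (let x' = ray_exit X y x; y' = ray_exit X x y
        in ln ((dist x y' * dist y x') / (dist x x' * dist y y')))
     else 0)"

lemma in_open_segment_iff_beyond:
  fixes x y z :: "'a::real_vector"
  assumes "x \<noteq> y"
  shows "y \<in> open_segment x z \<longleftrightarrow> (\<exists>t>0. z = y + t *\<^sub>R (y - x))"
proof
  assume "y \<in> open_segment x z"
  then obtain u where u: "0 < u" "u < 1" "y = (1 - u) *\<^sub>R x + u *\<^sub>R z"
    by (auto simp: in_segment)
  have "y + ((1 - u) / u) *\<^sub>R (y - x) = (1 / u) *\<^sub>R (y - (1 - u) *\<^sub>R x)"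
    using u(1) by (simp add: algebra_simps diff_divide_distrib)
  also have "\<dots> = z" using u by simp
  finally show "\<exists>t>0. z = y + t *\<^sub>R (y - x)"
    using u by (intro exI[of _ "(1 - u) / u"]) auto
next
  assume "\<exists>t>0. z = y + t *\<^sub>R (y - x)"
  then obtain t where t: "t > 0" "z = y + t *\<^sub>R (y - x)" by blast
  have "z - x = (1 + t) *\<^sub>R (y - x)" using t by (simp add: algebra_simps)
  then have "x \<noteq> z" using t assms by auto
  have "(1 / (1 + t)) *\<^sub>R (z - x) = y - x"
    using \<open>z - x = _\<close> t by simp
  then have "y = (1 - 1 / (1 + t)) *\<^sub>R x + (1 / (1 + t)) *\<^sub>R z"
    by (simp add: algebra_simps)
  moreover have "0 < 1 / (1 + t)" "1 / (1 + t) < 1" using t(1) by simp_all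
  ultimately show "y \<in> open_segment x z"
    using \<open>x \<noteq> z\<close> unfolding in_segment by blast
qed

lemma ray_exit_ex1:
  fixes X :: "'a::euclidean_space set"
  assumes X: "open X" "convex X" "bounded X" and xy: "x \<in> X" "y \<in> X" "x \<noteq> y"
  shows "\<exists>!z. z \<in> frontier X \<and> y \<in> open_segment x z"
proof -
  have int: "interior X = X" using X by (simp add: interior_open)
  obtain d where d: "0 < d" "y + d *\<^sub>R (y - x) \<in> frontier X"
    using ray_to_frontier[of X y "y - x"] X xy int
    by (metis eq_iff_diff_eq_0)
  have less: False if "0 < s" "s < t" "y + s *\<^sub>R (y - x) \<in> frontier X"
    "y + t *\<^sub>R (y - x) \<in> frontier X" for s t
  proof -
    have "y + s *\<^sub>R (y - x) \<in> open_segment y (y + t *\<^sub>R (y - x))"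
      using that xy by (auto simp: in_segment algebra_simps intro!: exI[of _ "s / t"])
    moreover have "open_segment y (y + t *\<^sub>R (y - x)) \<subseteq> interior X"
      using that xy int X by (intro in_interior_closure_convex_segment) (auto simp: frontier_def)
    ultimately show False using that by (auto simp: frontier_def)
  qed
  show ?thesis
    unfolding in_open_segment_iff_beyond[OF xy(3)]
  proof (rule ex1I[of _ "y + d *\<^sub>R (y - x)"])
    fix z assume z: "z \<in> frontier X \<and> (\<exists>t>0. z = y + t *\<^sub>R (y - x))"
    then obtain t where t: "t > 0" "z = y + t *\<^sub>R (y - x)" by blast
    then have "t = d"
      using z d less[of t d] less[of d t] by (cases t d rule: linorder_cases) simp_all
    with t show "z = y + d *\<^sub>R (y - x)" by simp
  qed (use d in blast)
qed

lemma ray_exit: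
  fixes X :: "'a::euclidean_space set"
  assumes "open X" "convex X" "bounded X" "x \<in> X" "y \<in> X" "x \<noteq> y"
  shows "ray_exit X x y \<in> frontier X" "y \<in> open_segment x (ray_exit X x y)"
  using theI'[OF ray_exit_ex1[OF assms]] by (auto simp: ray_exit_def)

lemma ray_exit_unique:
  fixes X :: "'a::euclidean_space set"
  assumes "open X" "convex X" "bounded X" "x \<in> X" "y \<in> X" "x \<noteq> y"
    and "z \<in> frontier X" "y \<in> open_segment x z"
  shows "z = ray_exit X x y"
  unfolding ray_exit_def
  by (rule the1_equality[symmetric, OF ray_exit_ex1[OF assms(1-6)]]) (use assms in blast)

lemma line_Int_frontier:
  fixes X :: "'a::euclidean_space set"
  assumes X: "open X" "convex X" "bounded X" and xy: "x \<in> X" "y \<in> X" "x \<noteq> y"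
  shows "affine hull {x, y} \<inter> frontier X = {ray_exit X y x, ray_exit X x y}"
    and "ray_exit X y x \<noteq> ray_exit X x y"
proof -
  have yx: "y \<noteq> x" using xy by auto
  note ex = ray_exit[OF X xy] ray_exit[OF X xy(2,1) yx]
  obtain s where s: "s > 0" "ray_exit X x y = y + s *\<^sub>R (y - x)"
    using ex(2) in_open_segment_iff_beyond[OF xy(3)] by blast
  obtain t where t: "t > 0" "ray_exit X y x = x + t *\<^sub>R (x - y)"
    using ex(4) in_open_segment_iff_beyond[OF yx] by blast
  have disj: "frontier X \<inter> X = {}" using X by (auto simp: frontier_def interior_open)
  have "ray_exit X x y - ray_exit X y x = (1 + s + t) *\<^sub>R (y - x)"
    by (simp add: s t algebra_simps)
  then show "ray_exit X y x \<noteq> ray_exit X x y"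
    using s t xy by auto
  show "affine hull {x, y} \<inter> frontier X = {ray_exit X y x, ray_exit X x y}"
  proof (intro equalityI subsetI)
    fix z assume z: "z \<in> affine hull {x, y} \<inter> frontier X"
    then obtain u v where uv: "z = u *\<^sub>R x + v *\<^sub>R y" "u + v = 1"
      by (auto simp: affine_hull_2)
    consider "v < 0" | "0 \<le> v" "0 \<le> u" | "u < 0" by linarith
    then show "z \<in> {ray_exit X y x, ray_exit X x y}"
    proof cases
      case 1
      have "u = 1 - v" using uv by simp
      then have "z = x + (- v) *\<^sub>R (x - y)"
        unfolding uv(1) \<open>u = 1 - v\<close> by (simp add: algebra_simps)
      then have "x \<in> open_segment y z"
        unfolding in_open_segment_iff_beyond[OF yx] using 1
        by (intro exI[of _ "- v"]) simp
      then show ?thesis using ray_exit_unique[OF X xy(2,1) yx] z by blast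
    next
      case 2
      then have "z \<in> X" using uv X(2) xy by (auto simp: convex_def)
      then show ?thesis using z disj by auto
    next
      case 3
      have "v = 1 - u" using uv by simp
      then have "z = y + (- u) *\<^sub>R (y - x)"
        unfolding uv(1) \<open>v = 1 - u\<close> by (simp add: algebra_simps)
      then have "y \<in> open_segment x z"
        unfolding in_open_segment_iff_beyond[OF xy(3)] using 3
        by (intro exI[of _ "- u"]) simp
      then show ?thesis using ray_exit_unique[OF X xy] z by blast
    qed
  next
    fix z assume z: "z \<in> {ray_exit X y x, ray_exit X x y}"
    have "(1 + t) *\<^sub>R x + (- t) *\<^sub>R y \<in> affine hull {x, y}"
         "(- s) *\<^sub>R x + (1 + s) *\<^sub>R y \<in> affine hull {x, y}"
      by (rule mem_affine; simp add: hull_inc)+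
    moreover have "ray_exit X y x = (1 + t) *\<^sub>R x + (- t) *\<^sub>R y"
      "ray_exit X x y = (- s) *\<^sub>R x + (1 + s) *\<^sub>R y"
      by (simp_all add: s t algebra_simps)
    ultimately show "z \<in> affine hull {x, y} \<inter> frontier X"
      using z ex by (metis IntI insertE singletonD)
  qed
qed

text \<open>The exponential of the Funk distance, the non-symmetric half of the Hilbert distance.\<close>

definition exit_ratio :: "'a::euclidean_space set \<Rightarrow> 'a \<Rightarrow> 'a \<Rightarrow> real" where
  "exit_ratio X x y = (if x = y then 1 else dist x (ray_exit X x y) / dist y (ray_exit X x y))"

lemma exit_ratio_eq:
  fixes X :: "'a::euclidean_space set"
  assumes X: "open X" "convex X" "bounded X" and xy: "x \<in> X" "y \<in> X" "x \<noteq> y"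
  obtains t where "t > 0" "ray_exit X x y = y + t *\<^sub>R (y - x)" "exit_ratio X x y = (1 + t) / t"
proof -
  obtain t where t: "t > 0" "ray_exit X x y = y + t *\<^sub>R (y - x)"
    using ray_exit[OF X xy] in_open_segment_iff_beyond[OF xy(3)] by blast
  have "x - ray_exit X x y = (1 + t) *\<^sub>R (x - y)" "y - ray_exit X x y = t *\<^sub>R (x - y)"
    by (simp_all add: t algebra_simps)
  then have "dist x (ray_exit X x y) = (1 + t) * norm (x - y)"
    "dist y (ray_exit X x y) = t * norm (x - y)"
    using t(1) by (simp_all add: dist_norm)
  then have "exit_ratio X x y = (1 + t) / t"
    using xy by (simp add: exit_ratio_def)
  then show ?thesis by (rule that[OF t])
qed

lemma exit_ratio_gt_1:
  fixes X :: "'a::euclidean_space set"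
  assumes "open X" "convex X" "bounded X" "x \<in> X" "y \<in> X" "x \<noteq> y"
  shows "exit_ratio X x y > 1"
proof -
  obtain t where t: "t > 0" "exit_ratio X x y = (1 + t) / t"
    by (rule exit_ratio_eq[OF assms])
  show ?thesis unfolding t(2) using t(1) by (simp add: field_simps)
qed

lemma exit_ratio_ge_1:
  fixes X :: "'a::euclidean_space set"
  assumes "open X" "convex X" "bounded X" "x \<in> X" "y \<in> X"
  shows "exit_ratio X x y \<ge> 1"
  using exit_ratio_gt_1[OF assms] by (cases "x = y") (auto simp: exit_ratio_def)

lemma hilbert_dist_eq_exit_ratio:
  "hilbert_dist X x y = (if x \<in> X \<and> y \<in> X then ln (exit_ratio X x y * exit_ratio X y x) else 0)"
  by (auto simp: hilbert_dist_def exit_ratio_def Let_def mult.commute)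

lemma exit_ratio_bound:
  fixes X :: "'a::euclidean_space set"
  assumes X: "open X" "convex X" "bounded X" and xy: "x \<in> X" "y \<in> X"
    and a: "\<And>p. p \<in> closure X \<Longrightarrow> c \<le> a \<bullet> p"
  shows "a \<bullet> x - c \<le> exit_ratio X x y * (a \<bullet> y - c)"
proof (cases "x = y")
  case False
  obtain t where t: "t > 0" "ray_exit X x y = y + t *\<^sub>R (y - x)" "exit_ratio X x y = (1 + t) / t"
    using exit_ratio_eq[OF X xy False] .
  have "c \<le> a \<bullet> (y + t *\<^sub>R (y - x))"
    using a[of "ray_exit X x y"] ray_exit(1)[OF X xy False] t(2) by (auto simp: frontier_def)
  then have "t * (a \<bullet> x - c) \<le> (1 + t) * (a \<bullet> y - c)"
    by (simp add: inner_simps algebra_simps)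
  then show ?thesis
    unfolding t(3) times_divide_eq_left pos_le_divide_eq[OF t(1)] by (metis mult.commute)
qed (simp add: exit_ratio_def)

lemma exit_ratio_triangle:
  fixes X :: "'a::euclidean_space set"
  assumes X: "open X" "convex X" "bounded X" and xyz: "x \<in> X" "y \<in> X" "z \<in> X"
  shows "exit_ratio X x z \<le> exit_ratio X x y * exit_ratio X y z"
proof (cases "x = z")
  case True
  have "1 * 1 \<le> exit_ratio X x y * exit_ratio X y z"
    using exit_ratio_ge_1[OF X] xyz by (intro mult_mono) (auto intro: order_trans[of 0 1])
  with True show ?thesis by (simp add: exit_ratio_def)
next
  case False
  define w where "w = ray_exit X x z"
  obtain t where t: "t > 0" "w = z + t *\<^sub>R (z - x)" "exit_ratio X x z = (1 + t) / t"
    using exit_ratio_eq[OF X xyz(1,3) False] unfolding w_def .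
  have w: "w \<in> closure X" "w \<notin> rel_interior X"
    using ray_exit(1)[OF X xyz(1,3) False] X
    by (auto simp: w_def frontier_def interior_open rel_interior_open)
  obtain a where a: "\<And>p. p \<in> closure X \<Longrightarrow> a \<bullet> w \<le> a \<bullet> p"
    "\<And>p. p \<in> rel_interior X \<Longrightarrow> a \<bullet> w < a \<bullet> p"
    using supporting_hyperplane_relative_frontier[OF X(2) w] by metis
  have pos: "a \<bullet> z - a \<bullet> w > 0" using a(2)[of z] xyz X by (simp add: rel_interior_open)
  have "t * (a \<bullet> x - a \<bullet> w) = (1 + t) * (a \<bullet> z - a \<bullet> w)"
    unfolding t(2) by (simp add: inner_simps algebra_simps)
  then have "exit_ratio X x z * (a \<bullet> z - a \<bullet> w) = a \<bullet> x - a \<bullet> w"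
    unfolding t(3) times_divide_eq_left using t(1) by (metis nonzero_mult_div_cancel_left less_irrefl)
  also have "\<dots> \<le> exit_ratio X x y * (a \<bullet> y - a \<bullet> w)"
    using exit_ratio_bound[OF X xyz(1,2)] a(1) by blast
  also have "\<dots> \<le> exit_ratio X x y * (exit_ratio X y z * (a \<bullet> z - a \<bullet> w))"
    using exit_ratio_bound[OF X xyz(2,3)] a(1) exit_ratio_ge_1[OF X xyz(1,2)]
    by (intro mult_left_mono) auto
  finally show ?thesis using pos by (simp add: mult.assoc[symmetric])
qed

theorem Metric_space_hilbert_dist:
  fixes X :: "'a::euclidean_space set"
  assumes X: "open X" "convex X" "bounded X"
  shows "Metric_space X (hilbert_dist X)"
proof
  note ge = exit_ratio_ge_1[OF X]
  have pos: "exit_ratio X x y > 0" if "x \<in> X" "y \<in> X" for x y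
    using ge[OF that] by linarith
  have prod: "1 \<le> exit_ratio X x y * exit_ratio X y x" if "x \<in> X" "y \<in> X" for x y
    using mult_mono[OF ge[OF that] ge[OF that(2,1)]] ge[OF that] by simp
  show "0 \<le> hilbert_dist X x y" for x y
    using prod by (auto simp: hilbert_dist_eq_exit_ratio)
  show "hilbert_dist X x y = hilbert_dist X y x" for x y
    by (simp add: hilbert_dist_eq_exit_ratio mult.commute)
  show "hilbert_dist X x y = 0 \<longleftrightarrow> x = y" if xy: "x \<in> X" "y \<in> X" for x y
  proof
    assume 0: "hilbert_dist X x y = 0"
    show "x = y"
    proof (rule ccontr)
      assume ne: "x \<noteq> y"
      have "1 < exit_ratio X x y * exit_ratio X y x"
        using exit_ratio_gt_1[OF X xy ne] exit_ratio_gt_1[OF X xy(2,1)] ne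
        by (intro less_1_mult) auto
      then show False using 0 xy by (simp add: hilbert_dist_eq_exit_ratio)
    qed
  qed (simp add: hilbert_dist_def)
  show "hilbert_dist X x z \<le> hilbert_dist X x y + hilbert_dist X y z"
    if xyz: "x \<in> X" "y \<in> X" "z \<in> X" for x y z
  proof -
    have "exit_ratio X x z * exit_ratio X z x
      \<le> (exit_ratio X x y * exit_ratio X y z) * (exit_ratio X z y * exit_ratio X y x)"
      using exit_ratio_triangle[OF X xyz] exit_ratio_triangle[OF X xyz(3,2,1)] pos xyz
      by (intro mult_mono) (auto intro!: less_imp_le mult_pos_pos)
    also have "\<dots> = (exit_ratio X x y * exit_ratio X y x) * (exit_ratio X y z * exit_ratio X z y)"
      by (simp add: mult_ac)
    finally have "ln (exit_ratio X x z * exit_ratio X z x)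
      \<le> ln ((exit_ratio X x y * exit_ratio X y x) * (exit_ratio X y z * exit_ratio X z y))"
      using pos xyz by (subst ln_le_cancel_iff) auto
    also have "\<dots> = ln (exit_ratio X x y * exit_ratio X y x) + ln (exit_ratio X y z * exit_ratio X z y)"
      using pos xyz by (intro ln_mult_pos) auto
    finally show ?thesis using xyz by (simp add: hilbert_dist_eq_exit_ratio)
  qed
qed

section \<open>Uniform contractibility\<close>

text \<open>\<open>id\<close> is the inclusion of the balls. As \<open>mcball y R\<close> contains \<open>y\<close>, the homotopy forces
  \<open>c \<in> mcball y S\<close>.\<close>

definition (in Metric_space) uniformly_contractible :: bool where
  "uniformly_contractible \<longleftrightarrow>
    (\<forall>R>0. \<exists>S\<ge>R. \<forall>y\<in>M. \<exists>c.
       homotopic_with (\<lambda>_. True)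
         (subtopology mtopology (mcball y R)) (subtopology mtopology (mcball y S))
         id (\<lambda>_. c))"

end

theory Submission
  imports Defs
begin

text \<open>
  Contract a closed ball to its centre \<open>y\<close> along Euclidean segments. Along a chord of \<open>X\<close> the Hilbert
  distance from \<open>y\<close> grows: the factors \<open>exit_ratio\<close> of \<open>exp (hilbert_dist X y x)\<close> are
  \<open>1 + |yx| / |xx'|\<close> and \<open>1 + |xy| / |yy'|\<close>, where \<open>x'\<close> and \<open>y'\<close> are the endpoints of the chord beyond \<open>x\<close>
  and \<open>y\<close>, and moving \<open>x\<close> away from \<open>y\<close> increases \<open>|xy|\<close>, decreases \<open>|xx'|\<close> and leaves \<open>|yy'|\<close> alone
  (\<open>hilbert_dist_mono_segment\<close>). So balls are star-shaped about their centres, the contraction never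
  leaves the ball, and \<open>S = R\<close> works.

  It remains to see that this contraction, which is plainly continuous for the Euclidean topology, is
  continuous for the metric topology; the two coincide (\<open>mtopology_hilbert_dist\<close>). This too can
  be read off the formula \<open>1 + |xy| / |yy'|\<close>: the distance \<open>|yy'|\<close> to the boundary is bounded above because \<open>X\<close>
  is bounded, and bounded below near any given point because \<open>X\<close> is open.
\<close>

section \<open>Exit ratios through the distance to the boundary\<close>

lemma dist_add_in_open_segment:
  fixes x y z :: "'a::euclidean_space"
  assumes "y \<in> open_segment x z"
  shows "dist x z = dist x y + dist y z"
  using assms by (metis between between_mem_segment open_closed_segment)

lemma in_open_segment_extend:
  fixes x y z w :: "'a::real_vector"
  assumes z: "z \<in> open_segment y x" and x: "x \<in> open_segment y w"
  shows "z \<in> open_segment y w" "x \<in> open_segment z w"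
proof -
  have "y \<noteq> x" using z by auto
  obtain u where u: "0 < u" "u < 1" "z = (1 - u) *\<^sub>R y + u *\<^sub>R x"
    using z by (auto simp: in_segment)
  obtain t where t: "t > 0" "w = x + t *\<^sub>R (x - y)"
    using x in_open_segment_iff_beyond[OF \<open>y \<noteq> x\<close>] by blast
  have zy: "z - y = u *\<^sub>R (x - y)" and xz: "x - z = (1 - u) *\<^sub>R (x - y)"
    by (simp_all add: u(3) algebra_simps)
  have ne: "y \<noteq> z" "z \<noteq> x"
    using z by (auto simp: open_segment_def)
  have "w = z + ((1 - u + t) / u) *\<^sub>R (z - y)"
    using u(1) by (simp add: zy) (simp add: u(3) t(2) algebra_simps)
  moreover have "(1 - u + t) / u > 0" using u t by simp
  ultimately show "z \<in> open_segment y w"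
    unfolding in_open_segment_iff_beyond[OF ne(1)] by blast
  have "w = x + (t / (1 - u)) *\<^sub>R (x - z)"
    using u(2) by (simp add: xz t(2))
  moreover have "t / (1 - u) > 0" using u t by simp
  ultimately show "x \<in> open_segment z w"
    unfolding in_open_segment_iff_beyond[OF ne(2)] by blast
qed

context
  fixes X :: "'a::euclidean_space set"
  assumes X: "open X" "convex X" "bounded X"
begin

lemma exit_ratio_eq_1_plus:
  assumes xy: "x \<in> X" "y \<in> X" "x \<noteq> y"
  shows "exit_ratio X x y = 1 + dist x y / dist y (ray_exit X x y)"
    and "dist y (ray_exit X x y) > 0"
proof -
  note ex = ray_exit[OF X xy]
  have "frontier X \<inter> X = {}" using X by (auto simp: frontier_def interior_open)
  with ex(1) xy show pos: "dist y (ray_exit X x y) > 0" by auto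
  show "exit_ratio X x y = 1 + dist x y / dist y (ray_exit X x y)"
    using pos dist_add_in_open_segment[OF ex(2)] xy by (simp add: exit_ratio_def field_simps)
qed

lemma exit_ratio_le_of_ball_subset:
  assumes xy: "x \<in> X" "y \<in> X" and e: "e > 0" "ball y e \<subseteq> X"
  shows "exit_ratio X x y \<le> 1 + dist x y / e"
proof (cases "x = y")
  case False
  have "ray_exit X x y \<notin> X"
    using ray_exit(1)[OF X xy False] X by (auto simp: frontier_def interior_open)
  then have "e \<le> dist y (ray_exit X x y)" using e by (force simp: ball_def)
  then show ?thesis
    using e by (auto simp: exit_ratio_eq_1_plus(1)[OF xy False] intro!: frac_le)
qed (simp add: exit_ratio_def)

lemma exit_ratio_ge_of_diameter:
  assumes xy: "x \<in> X" "y \<in> X"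
  shows "1 + dist x y / diameter X \<le> exit_ratio X x y"
proof (cases "x = y")
  case False
  have "ray_exit X x y \<in> closure X"
    using ray_exit(1)[OF X xy False] by (simp add: frontier_def)
  then have "dist y (ray_exit X x y) \<le> diameter X"
    using diameter_bounded_bound[of "closure X"] X xy closure_subset
    by (metis bounded_closure diameter_closure subsetD)
  then show ?thesis
    using exit_ratio_eq_1_plus[OF xy False] by (auto intro!: frac_le)
qed (simp add: exit_ratio_def)

section \<open>Balls are star-shaped\<close>

lemma ray_exit_segment:
  assumes yx: "y \<in> X" "x \<in> X" and z: "z \<in> open_segment y x"
  shows "ray_exit X y z = ray_exit X y x" "ray_exit X z y = ray_exit X x y"
proof -
  have ne: "y \<noteq> x" "z \<noteq> y" using z by (auto simp: open_segment_def)
  have "z \<in> X"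
    using z yx X(2) by (meson convex_contains_open_segment subsetD)
  note yxz = ray_exit[OF X yx ne(1)] ray_exit[OF X yx(2,1) ne(1)[symmetric]]
  have "z \<in> open_segment y (ray_exit X y x)"
    using in_open_segment_extend(1)[OF z yxz(2)] .
  then show "ray_exit X y z = ray_exit X y x"
    using ray_exit_unique[OF X yx(1) \<open>z \<in> X\<close> ne(2)[symmetric] yxz(1)] by simp
  have "y \<in> open_segment z (ray_exit X x y)"
    using in_open_segment_extend(2)[OF _ yxz(4)] z by (metis open_segment_commute)
  then show "ray_exit X z y = ray_exit X x y"
    using ray_exit_unique[OF X \<open>z \<in> X\<close> yx(1) ne(2) yxz(3)] by simp
qed

text \<open>By \<open>exit_ratio_eq_1_plus\<close> and \<open>ray_exit_segment\<close>, both exit ratios are at most those for \<open>x\<close>: on the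
  way from \<open>y\<close> to \<open>x\<close>, the distance to \<open>y\<close> is smaller and the distance to the exit beyond \<open>x\<close> is larger.\<close>

lemma hilbert_dist_mono_segment:
  assumes yx: "y \<in> X" "x \<in> X" and z: "z \<in> closed_segment y x"
  shows "hilbert_dist X y z \<le> hilbert_dist X y x"
proof -
  consider "z = x" | "z = y" | "z \<in> open_segment y x"
    using z by (auto simp: open_segment_def)
  then show ?thesis
  proof cases
    case 2
    then show ?thesis
      using Metric_space.nonneg[OF Metric_space_hilbert_dist[OF X]] by (simp add: hilbert_dist_def)
  next
    case 3
    then have ne: "y \<noteq> x" "z \<noteq> y" by (auto simp: open_segment_def)
    have zX: "z \<in> X"
      using 3 yx X(2) by (meson convex_contains_open_segment subsetD)
    note rs = ray_exit_segment[OF yx 3]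
    note eqs = exit_ratio_eq_1_plus[OF yx ne(1)] exit_ratio_eq_1_plus[OF yx(2,1) ne(1)[symmetric]]
      exit_ratio_eq_1_plus[OF yx(1) zX ne(2)[symmetric]] exit_ratio_eq_1_plus[OF zX yx(1) ne(2)]
    have d: "dist y x = dist y z + dist z x"
      by (rule dist_add_in_open_segment[OF 3])
    have "x \<in> open_segment z (ray_exit X y x)"
      using in_open_segment_extend(2)[OF 3] ray_exit[OF X yx ne(1)] by blast
    then have "dist x (ray_exit X y x) \<le> dist z (ray_exit X y x)"
      by (simp add: dist_add_in_open_segment)
    then have "dist y z / dist z (ray_exit X y x) \<le> dist y x / dist x (ray_exit X y x)"
      using d eqs(2) by (intro frac_le) auto
    then have le1: "exit_ratio X y z \<le> exit_ratio X y x"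
      using eqs(1,5) rs by simp
    have "dist z y / dist y (ray_exit X x y) \<le> dist x y / dist y (ray_exit X x y)"
      using d by (intro divide_right_mono) (auto simp: dist_commute)
    then have le2: "exit_ratio X z y \<le> exit_ratio X x y"
      using eqs(3,7) rs by simp
    note ge = exit_ratio_ge_1[OF X yx(1) zX] exit_ratio_ge_1[OF X zX yx(1)]
    have "exit_ratio X y z * exit_ratio X z y \<le> exit_ratio X y x * exit_ratio X x y"
      using le1 le2 ge by (intro mult_mono) auto
    moreover have "0 < exit_ratio X y z * exit_ratio X z y"
      using ge by (intro mult_pos_pos) auto
    ultimately show ?thesis
      using yx zX by (simp add: hilbert_dist_eq_exit_ratio)
  qed simp
qed

section \<open>The topology of the Hilbert metric\<close>

text \<open>Both exit ratios are at least \<open>1 + dist x y / diameter X\<close>; already one of these factors suffices, the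
  other being at least \<open>1\<close>.\<close>

lemma hilbert_dist_ge_ln:
  assumes xy: "x \<in> X" "y \<in> X"
  shows "ln (1 + dist x y / diameter X) \<le> hilbert_dist X x y"
proof -
  have "0 \<le> dist x y / diameter X"
    using diameter_ge_0[OF X(3)] by simp
  moreover have "(1 + dist x y / diameter X) * 1 \<le> exit_ratio X x y * exit_ratio X y x"
    using exit_ratio_ge_of_diameter[OF xy] exit_ratio_ge_1[OF X xy] exit_ratio_ge_1[OF X xy(2,1)]
    by (intro mult_mono) auto
  ultimately show ?thesis
    using xy by (simp add: hilbert_dist_eq_exit_ratio)
qed

text \<open>The points within \<open>e\<close> of \<open>x\<close> are still at distance at least \<open>e\<close> from the boundary, so both exit ratios are
  at most \<open>1 + dist x y / e\<close>, and \<open>ln (1 + s) \<le> s\<close>.\<close>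

lemma hilbert_dist_le_of_ball_subset:
  assumes e: "e > 0" "ball x (2 * e) \<subseteq> X" and y: "dist x y < e"
  shows "hilbert_dist X x y \<le> 2 * dist x y / e"
proof -
  have "ball x e \<subseteq> ball x (2 * e)" "ball y e \<subseteq> ball x (2 * e)"
    using e y by (simp_all add: ball_subset_ball_iff dist_commute)
  then have balls: "ball x e \<subseteq> X" "ball y e \<subseteq> X" using e by auto
  then have xy: "x \<in> X" "y \<in> X" using e by auto
  have pos: "exit_ratio X x y > 0" "exit_ratio X y x > 0"
    using exit_ratio_ge_1[OF X xy] exit_ratio_ge_1[OF X xy(2,1)] by auto
  have "ln (exit_ratio X x y) \<le> dist x y / e" "ln (exit_ratio X y x) \<le> dist x y / e"
    using ln_le_minus_one[OF pos(1)] exit_ratio_le_of_ball_subset[OF xy e(1) balls(2)]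
      ln_le_minus_one[OF pos(2)] exit_ratio_le_of_ball_subset[OF xy(2,1) e(1) balls(1)]
    by (simp_all add: dist_commute)
  then show ?thesis
    using xy pos by (simp add: hilbert_dist_eq_exit_ratio ln_mult_pos)
qed

lemma mtopology_hilbert_dist: "Metric_space.mtopology X (hilbert_dist X) = top_of_set X"
proof -
  interpret Metric_space X "hilbert_dist X"
    by (rule Metric_space_hilbert_dist[OF X])
  have small: "\<exists>e>0. ball x e \<inter> X \<subseteq> mball x r" if x: "x \<in> X" and r: "r > 0" for x r
  proof -
    obtain e where e: "e > 0" "ball x e \<subseteq> X"
      using X(1) x open_contains_ball by blast
    define a where "a = e / 2"
    have a: "a > 0" "ball x (2 * a) \<subseteq> X" using e by (auto simp: a_def)
    have "hilbert_dist X x y < r" if "dist x y < min a (a * r / 2)" for y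
    proof -
      have "hilbert_dist X x y \<le> 2 * dist x y / a"
        using hilbert_dist_le_of_ball_subset[OF a] that by simp
      also have "\<dots> < r" using that a by (simp add: field_simps)
      finally show ?thesis .
    qed
    then show ?thesis
      using a r x by (intro exI[of _ "min a (a * r / 2)"]) auto
  qed
  have large: "\<exists>r>0. mball x r \<subseteq> ball x e \<inter> X" if x: "x \<in> X" and e: "e > 0" for x e
  proof -
    have D: "diameter X > 0"
    proof -
      have "\<not> X \<subseteq> {x}"
        using X(1) x by (metis not_open_singleton subset_singletonD empty_iff)
      then obtain p where p: "p \<in> X" "p \<noteq> x" by auto
      then show ?thesis
        using diameter_bounded_bound[OF X(3) p(1) x] by (smt (verit) zero_less_dist_iff)
    qed
    have "dist x y < e" if "y \<in> X" "hilbert_dist X x y < ln (1 + e / diameter X)" for y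
    proof -
      have "ln (1 + dist x y / diameter X) < ln (1 + e / diameter X)"
        using hilbert_dist_ge_ln[OF x that(1)] that(2) by simp
      moreover have "0 < 1 + dist x y / diameter X" "0 < 1 + e / diameter X"
        using D e by (auto intro: add_pos_nonneg)
      ultimately show ?thesis using D by (simp add: divide_less_cancel)
    qed
    moreover have "ln (1 + e / diameter X) > 0" using D e by (intro ln_gt_zero) simp
    ultimately show ?thesis by (intro exI[of _ "ln (1 + e / diameter X)"]) auto
  qed
  have "openin mtopology U \<longleftrightarrow> openin (top_of_set X) U" for U
    unfolding openin_mtopology openin_contains_ball
    using small large by (meson subset_trans subsetD)
  then show ?thesis by (simp add: topology_eq)
qed

end

section \<open>Contracting balls\<close>

theorem proposition3p4:
  fixes X :: "(real ^ 'n) set"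
  assumes "CARD('n) \<ge> 2"
    and "X \<noteq> {}" and "open X" and "convex X" and "bounded X"
  shows "Metric_space.uniformly_contractible X (hilbert_dist X)"
proof -
  note X = assms(3-5)
  interpret Metric_space X "hilbert_dist X"
    by (rule Metric_space_hilbert_dist[OF X])
  have "homotopic_with (\<lambda>_. True)
      (subtopology mtopology (mcball y R)) (subtopology mtopology (mcball y R)) id (\<lambda>_. y)"
    if y: "y \<in> X" for y R
  proof -
    have "closed_segment x y \<subseteq> mcball y R" if x: "x \<in> mcball y R" for x
    proof
      fix z assume z: "z \<in> closed_segment x y"
      have xX: "x \<in> X" using x by simp
      have "z \<in> X"
        using z xX y X(2) by (meson convex_contains_segment subsetD)
      moreover have "hilbert_dist X y z \<le> R"
        using hilbert_dist_mono_segment[OF X y xX] x z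
        by (fastforce simp: closed_segment_commute)
      ultimately show "z \<in> mcball y R" using y by simp
    qed
    then have "homotopic_with (\<lambda>_. True) (top_of_set (mcball y R)) (top_of_set (mcball y R)) id (\<lambda>_. y)"
      by (intro homotopic_with_linear) (auto intro: continuous_intros)
    moreover have "X \<inter> mcball y R = mcball y R"
      using mcball_subset_mspace by blast
    ultimately show ?thesis
      by (simp add: mtopology_hilbert_dist[OF X] subtopology_subtopology)
  qed
  then show ?thesis
    unfolding uniformly_contractible_def by blast
qed

end
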